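(* Let $\nu$ be a lattice path from $(0,0)$ to $(b,a)$. The $\nu$-associahedron $A_\nu$ is contractible.
   Context: A lattice path from $(0,0)$ to $(b,a)\in\mathbb{Z}_{\ge0}^2$ is a sequence of $a$ north steps $N=(0,1)$ and $b$ east steps $E=(1,0)$. The $\nu$-associahedron. Let $n=a+b+2$ and let $I\sqcup\overline J=[n]$ be the partition with $1\in I$, $n\in\overline J$, and for $2\le k\le n-1$, $k\in I$ if the $(k-1)$-st step of $\nu$ is $E$ and $k\in\overline J$ if it is $N$. An $(I,\overline J)$-forest is a subgraph of the complete bipartite graph with parts $I$ and $\overline J$ that is increasing (each arc $(i,\overline j)$, $i\in I$, $\overline j\in\overline J$, has $i<\overline j$) and non-crossing (no two arcs $(i,\overline j)$, $(i',\overline j')$ with $i<i'<\overline j<\overline j'$). A covering $(I,\overline J)$-forest is one containing the arc $(1,n)$ and with no isolated nodes. The poset of covering $(I,\overline J)$-forests is ordered by $T\le T'$ iff the arcs of $T'$ are a subset of the arcs of $T$. The face poset of a polyhedral complex is the poset of its non-empty faces ordered by inclusion. The $\nu$-associahedron $A_\nu$ is the polyhedral complex (whose cells are convex polytopes) whose face poset is the poset of covering $(I,\overline J)$-forests; contractibility refers to its underlying topological space. *)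

theory Defs
  imports "HOL-Analysis.Analysis"
begin

section \<open>Lattice paths\<close>

datatype step = North | East

definition lattice_path :: "nat \<Rightarrow> nat \<Rightarrow> step list \<Rightarrow> bool"
  where "lattice_path b a \<nu> \<longleftrightarrow> count_list \<nu> East = b \<and> count_list \<nu> North = a"

section \<open>Covering forests\<close>

text \<open>
  The nodes are numbered \<open>1, \<dots>, n\<close>, where \<open>n = a + b + 2 = length \<nu> + 2\<close>. Lists are
  indexed from 0, so the \<open>(k-1)\<close>-st step of \<open>\<nu>\<close> is \<open>\<nu> ! (k - 2)\<close>.
\<close>

definition node_count :: "step list \<Rightarrow> nat"
  where "node_count \<nu> = length \<nu> + 2"

definition I_nodes :: "step list \<Rightarrow> nat set"
  where "I_nodes \<nu> = {1} \<union> {k. 2 \<le> k \<and> k \<le> node_count \<nu> - 1 \<and> \<nu> ! (k - 2) = East}"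

definition J_nodes :: "step list \<Rightarrow> nat set"
  where "J_nodes \<nu> = {node_count \<nu>} \<union> {k. 2 \<le> k \<and> k \<le> node_count \<nu> - 1 \<and> \<nu> ! (k - 2) = North}"

text \<open>
  A forest is represented by its set of arcs; a covering forest has no isolated nodes,
  so it is determined by its arcs.
\<close>

definition IJ_forest :: "nat set \<Rightarrow> nat set \<Rightarrow> (nat \<times> nat) set \<Rightarrow> bool"
  where "IJ_forest I J T \<longleftrightarrow>
    T \<subseteq> I \<times> J \<and>
    (\<forall>(i, j) \<in> T. i < j) \<and>
    \<not> (\<exists>i j i' j'. (i, j) \<in> T \<and> (i', j') \<in> T \<and> i < i' \<and> i' < j \<and> j < j')"

definition covering_forests :: "step list \<Rightarrow> (nat \<times> nat) set set"
  where "covering_forests \<nu> =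
    {T. IJ_forest (I_nodes \<nu>) (J_nodes \<nu>) T \<and>
        (1, node_count \<nu>) \<in> T \<and>
        (\<forall>i \<in> I_nodes \<nu>. \<exists>j. (i, j) \<in> T) \<and>
        (\<forall>j \<in> J_nodes \<nu>. \<exists>i. (i, j) \<in> T)}"

definition forest_le :: "(nat \<times> nat) set \<Rightarrow> (nat \<times> nat) set \<Rightarrow> bool"
  where "forest_le T T' \<longleftrightarrow> T' \<subseteq> T"

section \<open>Polyhedral complexes and the \<open>\<nu>\<close>-associahedron\<close>

text \<open>
  In the library, \<open>{}\<close> and \<open>C\<close> are both faces of a convex set \<open>C\<close>. Hence every non-empty
  complex contains the empty cell, which the face poset leaves out.
\<close>

definition polyhedral_complex :: "'a::euclidean_space set set \<Rightarrow> bool"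
  where "polyhedral_complex K \<longleftrightarrow>
    finite K \<and>
    (\<forall>C \<in> K. polyhedron C) \<and>
    (\<forall>C \<in> K. \<forall>F. F face_of C \<longrightarrow> F \<in> K) \<and>
    (\<forall>C \<in> K. \<forall>D \<in> K. (C \<inter> D) face_of C \<and> (C \<inter> D) face_of D)"

definition face_poset :: "'a::euclidean_space set set \<Rightarrow> 'a set set"
  where "face_poset K = K - {{}}"

definition order_isomorphism ::
    "'a set \<Rightarrow> ('a \<Rightarrow> 'a \<Rightarrow> bool) \<Rightarrow> 'b set \<Rightarrow> ('b \<Rightarrow> 'b \<Rightarrow> bool) \<Rightarrow> ('a \<Rightarrow> 'b) \<Rightarrow> bool"
  where "order_isomorphism P le Q le' f \<longleftrightarrow>
    bij_betw f P Q \<and> (\<forall>x \<in> P. \<forall>y \<in> P. le x y \<longleftrightarrow> le' (f x) (f y))"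

text \<open>
  The face poset determines a polytopal complex only up to combinatorial equivalence, so
  being the \<open>\<nu>\<close>-associahedron is a predicate on complexes: it holds of every geometric
  realisation, in a Euclidean space of any dimension.
\<close>

definition nu_associahedron :: "step list \<Rightarrow> 'a::euclidean_space set set \<Rightarrow> bool"
  where "nu_associahedron \<nu> K \<longleftrightarrow>
    polyhedral_complex K \<and>
    (\<forall>C \<in> K. polytope C) \<and>
    (\<exists>f. order_isomorphism (face_poset K) (\<subseteq>) (covering_forests \<nu>) forest_le f)"

end

theory Submission
  imports Defs
begin

text \<open>
  For a set \<open>S\<close> of arcs let the region of \<open>S\<close> be the union of the cells whose forest contains \<open>S\<close>;
  regions intersect by taking the union of the arc sets. If \<open>S\<close> is a non-crossing forest
  containing \<open>(1, n)\<close>, its region is an absolute retract, by induction on the number of nodes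
  that \<open>S\<close> leaves uncovered. If all nodes are covered, the region is a single polytope. Otherwise
  pick an uncovered node \<open>k\<close>: every covering forest has an arc at \<open>k\<close>, so the region of \<open>S\<close> is the
  union of the regions of \<open>S \<union> {e}\<close> over the arcs \<open>e\<close> at \<open>k\<close> compatible with \<open>S\<close>, and as arcs at a
  common node never cross, all intersections of these regions are covered by the induction
  hypothesis. The region of \<open>{(1, n)}\<close> is the whole complex.
\<close>

section \<open>Unions of absolute retracts\<close>

text \<open>Two closed absolute retracts with an absolute retract as intersection have an absolute
  retract as union; the rest is induction on \<open>T\<close>.\<close>

lemma AR_finite_UN:
  fixes X :: "'i \<Rightarrow> 'a::euclidean_space set"
  assumes "finite T" "T \<noteq> {}"
    and "\<And>t. t \<in> T \<Longrightarrow> closed (X t)"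
    and "\<And>T'. T' \<subseteq> T \<Longrightarrow> T' \<noteq> {} \<Longrightarrow> AR (\<Inter>t\<in>T'. X t)"
  shows "AR (\<Union>t\<in>T. X t)"
  using assms
proof (induction T arbitrary: X rule: finite_ne_induct)
  case (singleton t)
  show ?case using singleton(2)[of "{t}"] by simp
next
  case (insert t T)
  have 1: "AR (X t)" using insert.prems(2)[of "{t}"] by simp
  have 2: "AR (\<Union>s\<in>T. X s)" by (rule insert.IH) (use insert.prems in auto)
  \<comment> \<open>The traces on \<open>X t\<close> form a smaller family whose intersections are
    intersections of the original one. For this the induction keeps \<open>X\<close>
    arbitrary.\<close>
  have "AR (\<Union>s\<in>T. X t \<inter> X s)"
  proof (rule insert.IH)
    show "closed (X t \<inter> X s)" if "s \<in> T" for s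
      using insert.prems(1) that by (simp add: closed_Int)
    show "AR (\<Inter>s\<in>T'. X t \<inter> X s)" if "T' \<subseteq> T" "T' \<noteq> {}" for T'
    proof -
      have "(\<Inter>s\<in>T'. X t \<inter> X s) = (\<Inter>s\<in>insert t T'. X s)" using that by auto
      then show ?thesis using insert.prems(2)[of "insert t T'"] that by auto
    qed
  qed
  then have 3: "AR (X t \<inter> (\<Union>s\<in>T. X s))" by (simp only: Int_UN_distrib)
  have "closed (\<Union>s\<in>T. X s)" using insert by (intro closed_UN) auto
  then have "AR (X t \<union> (\<Union>s\<in>T. X s))"
    using AR_closed_Un[of "X t" "\<Union>s\<in>T. X s"] 1 2 3 insert.prems(1) by simp
  then show ?case by simp
qed

section \<open>Non-crossing forests\<close>

lemma IJ_forest_mono: "IJ_forest I J T \<Longrightarrow> S \<subseteq> T \<Longrightarrow> IJ_forest I J S"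
  unfolding IJ_forest_def by blast

text \<open>The definition's non-existence clause in a form that can be instantiated at two given
  arcs.\<close>

lemma IJ_forest_noncrossing:
  "IJ_forest I J S \<Longrightarrow> (i, j) \<in> S \<Longrightarrow> (i', j') \<in> S \<Longrightarrow> \<not> (i < i' \<and> i' < j \<and> j < j')"
  unfolding IJ_forest_def by blast

text \<open>Crossing concerns pairs of arcs and needs strict inequalities at both ends, so two arcs
  sharing an end \<open>k\<close> cannot cross.\<close>

lemma IJ_forest_Un_star:
  assumes "T \<noteq> {}" and "\<And>e. e \<in> T \<Longrightarrow> IJ_forest I J (insert e S)"
    and "(\<forall>e\<in>T. fst e = k) \<or> (\<forall>e\<in>T. snd e = k)"
  shows "IJ_forest I J (S \<union> T)"
proof -
  have sub: "S \<union> T \<subseteq> I \<times> J" and inc: "\<forall>(i, j) \<in> S \<union> T. i < j"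
    using assms(1,2) unfolding IJ_forest_def by blast+
  have "\<not> (i < i' \<and> i' < j \<and> j < j')" if arcs: "(i, j) \<in> S \<union> T" "(i', j') \<in> S \<union> T" for i j i' j'
  proof (cases "(i, j) \<in> T \<and> (i', j') \<in> T")
    case True
    then show ?thesis using assms(3) by (metis fst_conv snd_conv less_irrefl)
  next
    case False
    \<comment> \<open>At most one of the two arcs lies outside \<open>S\<close>; take it as
      \<open>e\<close>, or any element of \<open>T\<close> if there is none.\<close>
    then obtain e where "e \<in> T" "(i, j) \<in> insert e S" "(i', j') \<in> insert e S"
      using \<open>T \<noteq> {}\<close> arcs by blast
    then show ?thesis using IJ_forest_noncrossing[OF assms(2)] by blast
  qed
  then show ?thesis unfolding IJ_forest_def using sub inc by blast
qed

lemma IJ_forest_insert: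
  assumes "IJ_forest I J S" "i \<in> I" "j \<in> J" "i < j"
    and "\<And>i' j'. (i', j') \<in> S \<Longrightarrow> \<not> (i < i' \<and> i' < j \<and> j < j') \<and> \<not> (i' < i \<and> i < j' \<and> j' < j)"
  shows "IJ_forest I J (insert (i, j) S)"
proof -
  have "insert (i, j) S \<subseteq> I \<times> J" "\<forall>(i, j) \<in> insert (i, j) S. i < j"
    using assms(1-4) unfolding IJ_forest_def by blast+
  moreover have "\<not> (p < p' \<and> p' < q \<and> q < q')"
    if "(p, q) \<in> insert (i, j) S" "(p', q') \<in> insert (i, j) S" for p q p' q'
    using that assms(5) IJ_forest_noncrossing[OF assms(1), of p q p' q'] by fastforce
  ultimately show ?thesis unfolding IJ_forest_def by blast
qed

text \<open>The arc ends at the far end of an arc over \<open>k\<close> that is chosen to reach as little as possible.\<close>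

lemma exists_compatible_arc_from:
  assumes S: "IJ_forest I J S" and "(p, q) \<in> S" "p < k" "k < q" "k \<in> I"
  shows "\<exists>j. IJ_forest I J (insert (k, j) S)"
proof -
  define P where "P j \<longleftrightarrow> (\<exists>i. (i, j) \<in> S \<and> i < k \<and> k < j)" for j
  define j where "j = (LEAST j. P j)"
  have "P q" using assms unfolding P_def by blast
  then have "P j" unfolding j_def by (rule LeastI)
  have least: "j \<le> j'" if "P j'" for j' unfolding j_def using that by (rule Least_le)
  obtain i where i: "(i, j) \<in> S" "i < k" "k < j" using \<open>P j\<close> unfolding P_def by blast
  have "IJ_forest I J (insert (k, j) S)"
  proof (rule IJ_forest_insert[OF S \<open>k \<in> I\<close> _ \<open>k < j\<close>])
    show "j \<in> J" using S i(1) unfolding IJ_forest_def by blast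
    show "\<not> (k < i' \<and> i' < j \<and> j < j') \<and> \<not> (i' < k \<and> k < j' \<and> j' < j)"
      if "(i', j') \<in> S" for i' j'
    proof
      \<comment> \<open>Such an arc would also cross \<open>(i, j)\<close>, as
        \<open>i < k\<close>.\<close>
      show "\<not> (k < i' \<and> i' < j \<and> j < j')"
        using IJ_forest_noncrossing[OF S i(1) that] i by auto
      \<comment> \<open>Such an arc passes over \<open>k\<close> and ends before \<open>j\<close>,
        against minimality.\<close>
      show "\<not> (i' < k \<and> k < j' \<and> j' < j)"
        using least[of j'] that unfolding P_def by (meson leD)
    qed
  qed
  then show ?thesis ..
qed

text \<open>Mirror image: the new arc starts where an arc over \<open>k\<close> starts, chosen as
  close to \<open>k\<close> as possible.\<close>

lemma exists_compatible_arc_to: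
  assumes S: "IJ_forest I J S" and "(p, q) \<in> S" "p < k" "k < q" "k \<in> J"
  shows "\<exists>i. IJ_forest I J (insert (i, k) S)"
proof -
  define P where "P i \<longleftrightarrow> (\<exists>j. (i, j) \<in> S \<and> i < k \<and> k < j)" for i
  define i where "i = (GREATEST i. P i)"
  have bd: "\<And>i. P i \<Longrightarrow> i \<le> k" unfolding P_def by auto
  have "P p" using assms unfolding P_def by blast
  then have "P i" unfolding i_def using bd by (rule GreatestI_nat)
  have greatest: "i' \<le> i" if "P i'" for i' unfolding i_def using that bd by (rule Greatest_le_nat)
  obtain j where j: "(i, j) \<in> S" "i < k" "k < j" using \<open>P i\<close> unfolding P_def by blast
  have "IJ_forest I J (insert (i, k) S)"
  proof (rule IJ_forest_insert[OF S _ \<open>k \<in> J\<close> \<open>i < k\<close>])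
    show "i \<in> I" using S j(1) unfolding IJ_forest_def by blast
    show "\<not> (i < i' \<and> i' < k \<and> k < j') \<and> \<not> (i' < i \<and> i < j' \<and> j' < k)"
      if "(i', j') \<in> S" for i' j'
    proof
      show "\<not> (i < i' \<and> i' < k \<and> k < j')"
        using greatest[of i'] that unfolding P_def by (meson leD)
      show "\<not> (i' < i \<and> i < j' \<and> j' < k)"
        using IJ_forest_noncrossing[OF S that j(1)] j by auto
    qed
  qed
  then show ?thesis ..
qed

lemma I_nodes_bounds: "k \<in> I_nodes \<nu> \<Longrightarrow> 1 \<le> k \<and> k < node_count \<nu>"
  unfolding I_nodes_def node_count_def by auto

lemma J_nodes_bounds: "k \<in> J_nodes \<nu> \<Longrightarrow> 1 < k \<and> k \<le> node_count \<nu>"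
  unfolding J_nodes_def node_count_def by auto

lemma finite_I_nodes: "finite (I_nodes \<nu>)"
  by (rule finite_subset[of _ "{..node_count \<nu>}"]) (auto dest: I_nodes_bounds)

lemma finite_J_nodes: "finite (J_nodes \<nu>)"
  by (rule finite_subset[of _ "{..node_count \<nu>}"]) (auto dest: J_nodes_bounds)

section \<open>Regions of the complex\<close>

locale nu_complex =
  fixes \<nu> :: "step list" and K :: "'a::euclidean_space set set"
    and f :: "'a set \<Rightarrow> (nat \<times> nat) set"
  assumes complex: "polyhedral_complex K"
    and cells: "\<And>C. C \<in> K \<Longrightarrow> polytope C"
    and iso: "order_isomorphism (face_poset K) (\<subseteq>) (covering_forests \<nu>) forest_le f"
begin

abbreviation "I \<equiv> I_nodes \<nu>"
abbreviation "J \<equiv> J_nodes \<nu>"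
abbreviation "n \<equiv> node_count \<nu>"

definition region :: "(nat \<times> nat) set \<Rightarrow> 'a set"
  where "region S = \<Union>{C \<in> face_poset K. S \<subseteq> f C}"

lemma f_covering: "C \<in> face_poset K \<Longrightarrow> f C \<in> covering_forests \<nu>"
  using iso unfolding order_isomorphism_def bij_betw_def by blast

lemma f_antimono: "C \<in> face_poset K \<Longrightarrow> D \<in> face_poset K \<Longrightarrow> C \<subseteq> D \<longleftrightarrow> f D \<subseteq> f C"
  using iso unfolding order_isomorphism_def forest_le_def by blast

lemma closed_region: "closed (region S)"
  unfolding region_def
proof (rule closed_Union)
  show "finite {C \<in> face_poset K. S \<subseteq> f C}"
    using complex unfolding polyhedral_complex_def face_poset_def by simp
  show "\<forall>C \<in> {C \<in> face_poset K. S \<subseteq> f C}. closed C"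
    using cells polytope_imp_closed unfolding face_poset_def by blast
qed

lemma region_antimono: "S \<subseteq> S' \<Longrightarrow> region S' \<subseteq> region S"
  unfolding region_def by blast

text \<open>Two cells through a common point meet in a non-empty common face, whose forest contains
  both of theirs since \<open>f\<close> reverses inclusion.\<close>

lemma region_Un: "region (S \<union> S') = region S \<inter> region S'"
proof
  show "region (S \<union> S') \<subseteq> region S \<inter> region S'"
    by (simp add: region_antimono)
  show "region S \<inter> region S' \<subseteq> region (S \<union> S')"
  proof
    fix x assume "x \<in> region S \<inter> region S'"
    then obtain C D where C: "C \<in> face_poset K" "S \<subseteq> f C" "x \<in> C"
      and D: "D \<in> face_poset K" "S' \<subseteq> f D" "x \<in> D" unfolding region_def by blast
    have "C \<inter> D \<in> face_poset K"
      using complex C D unfolding polyhedral_complex_def face_poset_def by blast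
    moreover from this have "f C \<subseteq> f (C \<inter> D)" "f D \<subseteq> f (C \<inter> D)"
      using f_antimono C D by blast+
    ultimately show "x \<in> region (S \<union> S')"
      unfolding region_def using C D by blast
  qed
qed

lemma region_UN:
  assumes "finite T" "T \<noteq> {}"
  shows "region (\<Union>t\<in>T. g t) = (\<Inter>t\<in>T. region (g t))"
  using assms by (induction rule: finite_ne_induct) (simp_all add: region_Un)

text \<open>The cell labelled \<open>S\<close> contains every other cell of its region, so the
  region is one non-empty convex set.\<close>

lemma AR_region_covering:
  assumes "S \<in> covering_forests \<nu>"
  shows "AR (region S)"
proof -
  have "f ` face_poset K = covering_forests \<nu>"
    using iso unfolding order_isomorphism_def bij_betw_def by (elim conjE)
  then obtain C where C: "C \<in> face_poset K" "f C = S"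
    using assms by (metis imageE)
  have "region S = C"
  proof
    show "region S \<subseteq> C" unfolding region_def using C f_antimono[OF _ C(1)] by auto
    show "C \<subseteq> region S" unfolding region_def using C by auto
  qed
  moreover have "convex C" "C \<noteq> {}"
    using C cells polytope_imp_convex unfolding face_poset_def by blast+
  ultimately show ?thesis by (simp add: convex_imp_AR)
qed

text \<open>By \<open>meet\<close>, the regions of \<open>insert e S\<close> cover that of
  \<open>S\<close>; they intersect in regions of \<open>S \<union> T\<close>.\<close>

lemma AR_region_step:
  assumes "finite E" "E \<noteq> {}"
    and meet: "\<And>F. F \<in> covering_forests \<nu> \<Longrightarrow> S \<subseteq> F \<Longrightarrow> F \<inter> E \<noteq> {}"
    and AR: "\<And>T. T \<subseteq> E \<Longrightarrow> T \<noteq> {} \<Longrightarrow> AR (region (S \<union> T))"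
  shows "AR (region S)"
proof -
  have "AR (\<Union>e\<in>E. region (insert e S))"
  proof (rule AR_finite_UN[OF assms(1,2) closed_region])
    fix T assume T: "T \<subseteq> E" "T \<noteq> {}"
    have "S \<union> T = (\<Union>e\<in>T. insert e S)" using T by auto
    then have "region (S \<union> T) = (\<Inter>e\<in>T. region (insert e S))"
      using region_UN[OF finite_subset[OF T(1) \<open>finite E\<close>] T(2), of "\<lambda>e. insert e S"] by simp
    then show "AR (\<Inter>e\<in>T. region (insert e S))" using AR[OF T] by simp
  qed
  moreover have "region S = (\<Union>e\<in>E. region (insert e S))"
  proof
    show "region S \<subseteq> (\<Union>e\<in>E. region (insert e S))"
    proof
      fix x assume "x \<in> region S"
      then obtain C where "C \<in> face_poset K" "S \<subseteq> f C" "x \<in> C" unfolding region_def by blast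
      moreover from this obtain e where "e \<in> f C" "e \<in> E" using meet f_covering by blast
      ultimately show "x \<in> (\<Union>e\<in>E. region (insert e S))" unfolding region_def by blast
    qed
    show "(\<Union>e\<in>E. region (insert e S)) \<subseteq> region S"
      by (intro UN_least region_antimono) blast
  qed
  ultimately show ?thesis by simp
qed

lemma AR_region:
  assumes "IJ_forest I J S" "(1, n) \<in> S"
  shows "AR (region S)"
  using assms
proof (induction "card (I - fst ` S) + card (J - snd ` S)" arbitrary: S rule: less_induct)
  case less
  note S = less.prems
  \<comment> \<open>The inductive step for both kinds of uncovered node \<open>k\<close>, with
    \<open>E\<close> a set of arcs at \<open>k\<close>.\<close>
  have star: "AR (region S)"
    if E: "E \<subseteq> {e. IJ_forest I J (insert e S)}" "E \<noteq> {}"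
      and k: "(k \<in> I - fst ` S \<and> (\<forall>e\<in>E. fst e = k)) \<or> (k \<in> J - snd ` S \<and> (\<forall>e\<in>E. snd e = k))"
      and meet: "\<And>F. F \<in> covering_forests \<nu> \<Longrightarrow> S \<subseteq> F \<Longrightarrow> F \<inter> E \<noteq> {}" for E k
  proof (rule AR_region_step[OF _ \<open>E \<noteq> {}\<close> meet])
    have "E \<subseteq> I \<times> J" using E(1) unfolding IJ_forest_def by blast
    then show "finite E"
      using finite_subset finite_I_nodes finite_J_nodes by blast
    fix T assume T: "T \<subseteq> E" "T \<noteq> {}"
    have forest: "IJ_forest I J (S \<union> T)"
      by (rule IJ_forest_Un_star[where k = k]) (use T E k in auto)
    \<comment> \<open>Neither count grows, and the one that included \<open>k\<close> drops.\<close>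
    have le: "card (I - fst ` (S \<union> T)) \<le> card (I - fst ` S)"
      "card (J - snd ` (S \<union> T)) \<le> card (J - snd ` S)"
      by (intro card_mono; use finite_I_nodes finite_J_nodes in auto)+
    obtain e where "e \<in> T" using T by blast
    have "card (I - fst ` (S \<union> T)) < card (I - fst ` S) \<or>
      card (J - snd ` (S \<union> T)) < card (J - snd ` S)"
      using k
    proof
      assume "k \<in> I - fst ` S \<and> (\<forall>e\<in>E. fst e = k)"
      then have "k \<in> I - fst ` S" "k \<in> fst ` T" using \<open>e \<in> T\<close> T(1) by force+
      then have "I - fst ` (S \<union> T) \<subset> I - fst ` S" unfolding image_Un by blast
      then show ?thesis by (simp add: finite_I_nodes psubset_card_mono)
    next
      assume "k \<in> J - snd ` S \<and> (\<forall>e\<in>E. snd e = k)"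
      then have "k \<in> J - snd ` S" "k \<in> snd ` T" using \<open>e \<in> T\<close> T(1) by force+
      then have "J - snd ` (S \<union> T) \<subset> J - snd ` S" unfolding image_Un by blast
      then show ?thesis by (simp add: finite_J_nodes psubset_card_mono)
    qed
    then have "card (I - fst ` (S \<union> T)) + card (J - snd ` (S \<union> T))
        < card (I - fst ` S) + card (J - snd ` S)"
      using le by linarith
    then show "AR (region (S \<union> T))" using less.hyps forest S(2) by blast
  qed
  \<comment> \<open>Inside a covering forest containing \<open>S\<close>, every arc is compatible
    with \<open>S\<close>; hence the arc that it has at \<open>k\<close> lies in
    \<open>E\<close>.\<close>
  have forest_insert: "IJ_forest I J (insert e S)"
    if "F \<in> covering_forests \<nu>" "S \<subseteq> F" "e \<in> F" for F e
    using that IJ_forest_mono[of I J F "insert e S"] unfolding covering_forests_def by auto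
  consider (cov) "I \<subseteq> fst ` S" "J \<subseteq> snd ` S" | (I) k where "k \<in> I - fst ` S"
    | (J) k where "k \<in> J - snd ` S" by blast
  then show ?case
  proof cases
    case cov
    then have "S \<in> covering_forests \<nu>"
      using S unfolding covering_forests_def by force
    then show ?thesis by (rule AR_region_covering)
  next
    case (I k)
    define E where "E = {e. IJ_forest I J (insert e S) \<and> fst e = k}"
    \<comment> \<open>The arc \<open>(1, n)\<close> already covers node 1, so it passes strictly
      over \<open>k\<close>.\<close>
    have "k \<noteq> 1" using I S(2) by force
    then have "1 < k" "k < n" using I I_nodes_bounds[of k \<nu>] by auto
    then obtain j where "IJ_forest I J (insert (k, j) S)"
      using exists_compatible_arc_from[OF S] I by blast
    then have "E \<noteq> {}" unfolding E_def by force
    show ?thesis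
    proof (rule star[of E k])
      show "F \<inter> E \<noteq> {}" if F: "F \<in> covering_forests \<nu>" "S \<subseteq> F" for F
      proof -
        obtain j where "(k, j) \<in> F" using F I unfolding covering_forests_def by blast
        then have "(k, j) \<in> F \<inter> E" using forest_insert F unfolding E_def by simp
        then show ?thesis by blast
      qed
    qed (use \<open>E \<noteq> {}\<close> I in \<open>auto simp: E_def\<close>)
  next
    case (J k)
    define E where "E = {e. IJ_forest I J (insert e S) \<and> snd e = k}"
    \<comment> \<open>Likewise \<open>(1, n)\<close> covers node \<open>n\<close> and passes
      strictly over \<open>k\<close>.\<close>
    have "k \<noteq> n" using J S(2) by force
    then have "1 < k" "k < n" using J J_nodes_bounds[of k \<nu>] by auto
    then obtain i where "IJ_forest I J (insert (i, k) S)"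
      using exists_compatible_arc_to[OF S] J by blast
    then have "E \<noteq> {}" unfolding E_def by force
    show ?thesis
    proof (rule star[of E k])
      show "F \<inter> E \<noteq> {}" if F: "F \<in> covering_forests \<nu>" "S \<subseteq> F" for F
      proof -
        obtain i where "(i, k) \<in> F" using F J unfolding covering_forests_def by blast
        then have "(i, k) \<in> F \<inter> E" using forest_insert F unfolding E_def by simp
        then show ?thesis by blast
      qed
    qed (use \<open>E \<noteq> {}\<close> J in \<open>auto simp: E_def\<close>)
  qed
qed

lemma AR_complex: "AR (\<Union>K)"
proof -
  have "IJ_forest I J {(1, n)}"
  proof -
    have "1 \<in> I" "n \<in> J" "1 < n" unfolding I_nodes_def J_nodes_def node_count_def by simp_all
    then show ?thesis unfolding IJ_forest_def by simp
  qed
  then have "AR (region {(1, n)})" by (rule AR_region) simp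
  moreover have "region {(1, n)} = \<Union>(face_poset K)"
  proof -
    have "{(1, n)} \<subseteq> f C" if "C \<in> face_poset K" for C
      using f_covering[OF that] unfolding covering_forests_def by simp
    then have "{C \<in> face_poset K. {(1, n)} \<subseteq> f C} = face_poset K" by blast
    then show ?thesis unfolding region_def by simp
  qed
  moreover have "\<Union>(face_poset K) = \<Union>K" unfolding face_poset_def by blast
  ultimately show ?thesis by simp
qed

end

theorem theorem4p13:
  fixes \<nu> :: "step list" and a b :: nat
    and A :: "'a::euclidean_space set set"
  assumes "lattice_path b a \<nu>"
    and "nu_associahedron \<nu> A"
  shows "\<Union>A \<noteq> {} \<and> contractible (\<Union>A)"
proof -
  obtain f where "order_isomorphism (face_poset A) (\<subseteq>) (covering_forests \<nu>) forest_le f"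
    using assms(2) unfolding nu_associahedron_def by (elim conjE exE)
  then have "nu_complex \<nu> A f"
    using assms(2) unfolding nu_associahedron_def by (intro nu_complex.intro) simp_all
  then have "AR (\<Union>A)" by (rule nu_complex.AR_complex)
  \<comment> \<open>An absolute retract is the same as a non-empty contractible absolute
    neighbourhood retract.\<close>
  then show ?thesis by (simp add: AR_ANR)
qed

end
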